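(* Let $1<p,q<\infty$. Let $\mu$ be a finite Borel measure on $G$ and let $\phi$ be a $\mu$-measurable function such that, for some constants $A,B$, $0<A\le\phi(x)\le B<\infty$ for $\mu$-a.e. $x\in K_\mu$. Then a Borel measure $\nu$ on $\widehat{G}$ is a $(p,q)$-frame measure for $\mu$ if and only if $\nu$ is a $(p,q)$-frame measure for $\phi\,d\mu$.
   Context: $G$ is a locally compact Hausdorff abelian (LCA) group, written additively, which is metrizable and a countable union of compact sets; $\widehat{G}$ is its dual group (continuous characters), and $\langle x,\gamma\rangle$ denotes the value of $\gamma\in\widehat{G}$ at $x\in G$. Measures are non-negative. $K_\mu$ is the closed support of $\mu$: the smallest closed set $K\subset G$ with $\mu(K)=\mu(G)$. $\phi\,d\mu$ is the measure with density $\phi$ with respect to $\mu$. For a finite Borel measure $\mu$ on $G$ and $f\in L^1(\mu)$, $\widehat{fd\mu}(\gamma)=\int_G f(x)\overline{\langle x,\gamma\rangle}\,d\mu(x)$ for $\gamma\in\widehat{G}$. A Borel measure $\nu$ on $\widehat{G}$ is a $(p,q)$-frame measure for $\mu$ if there are constants $0<c\le d<\infty$ (frame bounds) with $c\|f\|_{L^p(\mu)}^q\le\|\widehat{fd\mu}\|_{L^q(\nu)}^q\le d\|f\|_{L^p(\mu)}^q$ for all $f\in L^p(\mu)$. *)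

theory Defs
  imports "HOL-Probability.Conditional_Expectation"
begin

definition dual_group :: "('a::topological_ab_group_add \<Rightarrow> complex) set" where
  "dual_group = {\<gamma>. continuous_on UNIV \<gamma> \<and> (\<forall>x. norm (\<gamma> x) = 1) \<and> (\<forall>x y. \<gamma> (x + y) = \<gamma> x * \<gamma> y)}"

text \<open>The compact-open topology, given by its subbasis. The choice \<open>K = {}\<close> makes the whole dual
  group a member of the subbasis, so it is the topspace.\<close>

definition dual_topology :: "('a::topological_ab_group_add \<Rightarrow> complex) topology" where
  "dual_topology =
     topology_generated_by {{\<gamma> \<in> dual_group. \<gamma> ` K \<subseteq> U} | K U. compact K \<and> open U}"

definition dual_borel :: "('a::topological_ab_group_add \<Rightarrow> complex) measure" where
  "dual_borel = sigma dual_group {W. openin dual_topology W}"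

text \<open>Real powers in \<open>[0, \<infinity>]\<close>, only meant for exponents \<open>r > 0\<close>.\<close>

definition ennreal_rpow :: "ennreal \<Rightarrow> real \<Rightarrow> ennreal" where
  "ennreal_rpow x r = (if x = \<infinity> then \<infinity> else ennreal (enn2real x powr r))"

definition Lp_norm :: "real \<Rightarrow> 'b measure \<Rightarrow> ('b \<Rightarrow> complex) \<Rightarrow> ennreal" where
  "Lp_norm p M f = ennreal_rpow (\<integral>\<^sup>+ x. ennreal (norm (f x) powr p) \<partial>M) (1 / p)"

definition Lp_space :: "real \<Rightarrow> 'b measure \<Rightarrow> ('b \<Rightarrow> complex) set" where
  "Lp_space p M = {f \<in> borel_measurable M. Lp_norm p M f < \<infinity>}"

definition fourier :: "'a measure \<Rightarrow> ('a \<Rightarrow> complex) \<Rightarrow> ('a \<Rightarrow> complex) \<Rightarrow> complex" where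
  "fourier \<mu> f \<gamma> = (\<integral>x. f x * cnj (\<gamma> x) \<partial>\<mu>)"

definition frame_measure ::
    "real \<Rightarrow> real \<Rightarrow> 'a measure \<Rightarrow> ('a::topological_ab_group_add \<Rightarrow> complex) measure \<Rightarrow> bool" where
  "frame_measure p q \<mu> \<nu> \<longleftrightarrow>
     sets \<nu> = sets dual_borel \<and>
     (\<exists>c d :: real. 0 < c \<and> c \<le> d \<and>
       (\<forall>f \<in> Lp_space p \<mu>.
          ennreal c * ennreal_rpow (Lp_norm p \<mu> f) q \<le> ennreal_rpow (Lp_norm q \<nu> (fourier \<mu> f)) q \<and>
          ennreal_rpow (Lp_norm q \<nu> (fourier \<mu> f)) q \<le> ennreal d * ennreal_rpow (Lp_norm p \<mu> f) q))"

definition closed_support :: "'a::topological_space measure \<Rightarrow> 'a set" where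
  "closed_support \<mu> = (LEAST K. closed K \<and> emeasure \<mu> K = emeasure \<mu> (space \<mu>))"

text \<open>The measure \<open>\<phi> d\<mu>\<close> on the \<open>\<sigma>\<close>-algebra of \<open>\<mu>\<close>. Since \<open>\<phi>\<close> need only be measurable with respect
  to the completion of \<open>\<mu>\<close>, the density is taken there and the result is restricted to \<open>sets \<mu>\<close>.\<close>

definition weighted_measure :: "('a \<Rightarrow> real) \<Rightarrow> 'a measure \<Rightarrow> 'a measure" where
  "weighted_measure \<phi> \<mu> = restr_to_subalg (density (completion \<mu>) (\<lambda>x. ennreal (\<phi> x))) \<mu>"

end

theory Submission
  imports Defs
begin

text \<open>Multiplication by \<open>\<phi>\<close> carries \<open>L\<^sup>p(\<phi> d\<mu>)\<close> onto \<open>L\<^sup>p(\<mu>)\<close>, turns the transform of \<open>f\<close> with respect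
  to \<open>\<phi> d\<mu>\<close> into that of \<open>\<phi> f\<close> with respect to \<open>\<mu>\<close>, and changes the \<open>p\<close>-th power of the norm only by
  factors between \<open>A\<^sup>p\<^sup>-\<^sup>1\<close> and \<open>B\<^sup>p\<^sup>-\<^sup>1\<close>. Since \<open>\<mu>\<close> is \<open>1/\<phi>\<close> times \<open>\<phi> d\<mu>\<close>, one
  implication gives both. The bounds on \<open>\<phi>\<close> hold almost everywhere because a \<open>\<sigma>\<close>-compact metrizable
  space is hereditarily Lindelof, so the complement of the closed support is a null set.\<close>

text \<open>An open set in a metrizable space is a countable union of closed sets. Cutting these
  with the compact sets \<open>K n\<close> exhibits it as a countable union of compact sets, hence
  as a Lindelof subspace.\<close>

lemma open_Union_countable_subcover:
  fixes \<U> :: "'a::topological_space set set" and K :: "nat \<Rightarrow> 'a set"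
  assumes met: "metrizable_space (euclidean :: 'a topology)"
    and K: "\<And>n. compact (K n)" "(\<Union>n. K n) = UNIV"
    and \<U>: "\<And>U. U \<in> \<U> \<Longrightarrow> open U"
  obtains \<V> where "countable \<V>" "\<V> \<subseteq> \<U>" "\<Union>\<V> = \<Union>\<U>"
proof -
  have "openin euclidean (\<Union>\<U>)"
    using \<U> by (simp add: open_Union)
  then have "fsigma_in euclidean (\<Union>\<U>)"
    by (rule open_imp_fsigma_in[OF met])
  then have "\<exists>\<C>. countable \<C> \<and> \<C> \<subseteq> Collect (closedin euclidean) \<and> \<Union>\<C> = \<Union>\<U>"
    unfolding fsigma_in_def union_of_def .
  then obtain \<C> where \<C>: "countable \<C>" "\<C> \<subseteq> Collect (closedin euclidean)" "\<Union>\<C> = \<Union>\<U>"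
    by (elim exE conjE)
  define \<K> where "\<K> = (\<lambda>(C, n). C \<inter> K n) ` (\<C> \<times> UNIV)"
  have cover: "\<Union>\<K> = \<Union>\<U>"
  proof -
    have "\<Union>\<K> = (\<Union>\<C>) \<inter> (\<Union>n. K n)"
      unfolding \<K>_def by auto
    then show ?thesis
      using \<C>(3) K(2) by simp
  qed
  have "Lindelof_space (subtopology euclidean (\<Union>\<K>))"
  proof (rule Lindelof_space_Union)
    show "countable \<K>"
      unfolding \<K>_def using \<C>(1) by simp
    show "Lindelof_space (subtopology euclidean U)" if "U \<in> \<K>" for U
      using that \<C>(2) K(1) unfolding \<K>_def
      by (auto intro!: compact_imp_Lindelof_space compact_space_subtopology
          simp: closed_Int_compact subset_iff)
  qed
  then have "\<forall>\<U>'. (\<forall>U \<in> \<U>'. open U) \<and> \<Union>\<U> \<subseteq> \<Union>\<U>'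
      \<longrightarrow> (\<exists>\<V>. countable \<V> \<and> \<V> \<subseteq> \<U>' \<and> \<Union>\<U> \<subseteq> \<Union>\<V>)"
    unfolding cover by (simp add: Lindelof_space_subtopology_subset)
  then obtain \<V> where "countable \<V>" "\<V> \<subseteq> \<U>" "\<Union>\<U> \<subseteq> \<Union>\<V>"
    using \<U> by (meson order_refl)
  then show thesis
    by (intro that[of \<V>]) auto
qed

text \<open>The union of all open null sets is itself null, because countably many of them already
  cover it. Its complement is therefore the smallest closed set of full measure, so the
  \<open>LEAST\<close> in \<open>closed_support\<close> is attained.\<close>

lemma AE_closed_support:
  fixes \<mu> :: "'a::topological_space measure" and K :: "nat \<Rightarrow> 'a set"
  assumes met: "metrizable_space (euclidean :: 'a topology)"
    and K: "\<And>n. compact (K n)" "(\<Union>n. K n) = UNIV"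
    and sets: "sets \<mu> = sets borel" and fin: "finite_measure \<mu>"
  shows "AE x in \<mu>. x \<in> closed_support \<mu>"
proof -
  interpret finite_measure \<mu> by fact
  have space: "space \<mu> = UNIV"
    using sets_eq_imp_space_eq[OF sets] by simp
  \<comment> \<open>Finiteness of \<mu> allows cancelling the measure of \<open>C\<close>, so closed
    sets of full measure correspond to open null sets.\<close>
  have full_iff: "emeasure \<mu> C = emeasure \<mu> (space \<mu>) \<longleftrightarrow> emeasure \<mu> (- C) = 0" if "closed C" for C
  proof -
    have "C \<in> sets \<mu>"
      using that sets by simp
    then have "emeasure \<mu> (space \<mu>) = emeasure \<mu> C + emeasure \<mu> (- C)"
      using plus_emeasure[of C \<mu> "- C"] sets space by (simp add: Compl_eq_Diff_UNIV)
    then show ?thesis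
      by (metis add.right_neutral emeasure_finite ennreal_add_left_cancel infinity_ennreal_def)
  qed
  define \<U> where "\<U> = {U. open U \<and> emeasure \<mu> U = 0}"
  obtain \<V> where \<V>: "countable \<V>" "\<V> \<subseteq> \<U>" "\<Union>\<V> = \<Union>\<U>"
    by (rule open_Union_countable_subcover[OF met K, of \<U>]) (auto simp: \<U>_def)
  have "\<Union>\<V> \<in> null_sets \<mu>"
  proof -
    have "U \<in> null_sets \<mu>" if "U \<in> \<V>" for U
      using that \<V>(2) sets by (intro null_setsI) (auto simp: \<U>_def)
    then show ?thesis
      using null_sets_UN'[of \<V> "\<lambda>U. U" \<mu>] \<V>(1) by simp
  qed
  then have null: "\<Union>\<U> \<in> null_sets \<mu>"
    using \<V>(3) by simp
  have "closed_support \<mu> = - \<Union>\<U>"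
    unfolding closed_support_def
  proof (rule Least_equality)
    have "closed (- \<Union>\<U>)"
      unfolding \<U>_def by (intro closed_Compl open_Union) simp
    then show "closed (- \<Union>\<U>) \<and> emeasure \<mu> (- \<Union>\<U>) = emeasure \<mu> (space \<mu>)"
      using null full_iff by (simp add: null_setsD1)
    show "- \<Union>\<U> \<subseteq> C" if "closed C \<and> emeasure \<mu> C = emeasure \<mu> (space \<mu>)" for C
      using that full_iff unfolding \<U>_def by (auto simp: open_Compl)
  qed
  then show ?thesis
    using AE_not_in[OF null] by simp
qed

lemma ennreal_rpow_rpow: "ennreal_rpow (ennreal_rpow x r) s = ennreal_rpow x (r * s)"
  by (simp add: ennreal_rpow_def powr_powr)

lemma ennreal_rpow_mono: "x \<le> y \<Longrightarrow> 0 \<le> r \<Longrightarrow> ennreal_rpow x r \<le> ennreal_rpow y r"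
  by (auto simp: ennreal_rpow_def top_unique less_top intro!: ennreal_leI powr_mono2 enn2real_mono)

lemma ennreal_rpow_cmult:
  assumes "0 < k"
  shows "ennreal_rpow (ennreal k * x) r = ennreal (k powr r) * ennreal_rpow x r"
  using assms
  by (cases x)
     (auto simp: ennreal_rpow_def powr_mult ennreal_mult ennreal_mult_top simp flip: ennreal_mult)

text \<open>By its definition \<open>ennreal_rpow\<close> takes the value infinity only at infinity,
  whatever the exponent.\<close>

lemma Lp_norm_finite_iff:
  "Lp_norm p M f < \<infinity> \<longleftrightarrow> (\<integral>\<^sup>+ x. ennreal (norm (f x) powr p) \<partial>M) < \<infinity>"
  by (auto simp: Lp_norm_def ennreal_rpow_def less_top)

text \<open>Pointwise, (\<phi>|f|)^p is \<phi>^(p-1) times \<phi>|f|^p, and the latter is the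
  integrand of \<open>I\<close> over \<open>M\<close>. As p - 1 is nonnegative, \<phi>^(p-1) lies
  between A^(p-1) and B^(p-1).\<close>

lemma nn_integral_powr_density_bounds:
  fixes \<phi> :: "'b \<Rightarrow> real" and f :: "'b \<Rightarrow> complex"
  assumes [measurable]: "\<phi> \<in> borel_measurable M" "f \<in> borel_measurable M"
    and \<phi>: "\<And>x. A \<le> \<phi> x" "\<And>x. \<phi> x \<le> B" and A: "0 < A" and p: "1 \<le> p"
  defines "I \<equiv> \<integral>\<^sup>+ x. ennreal (norm (f x) powr p) \<partial>density M (\<lambda>x. ennreal (\<phi> x))"
    and "J \<equiv> \<integral>\<^sup>+ x. ennreal (norm (\<phi> x *\<^sub>R f x) powr p) \<partial>M"
  shows "ennreal (A powr (p - 1)) * I \<le> J" "J \<le> ennreal (B powr (p - 1)) * I"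
proof -
  have pos: "0 < \<phi> x" for x
    using \<phi>(1)[of x] A by linarith
  \<comment> \<open>Moving the constant under the integral makes the comparison with
    \<open>J\<close> pointwise; \<open>k\<close> is \<open>A\<close> in one bound and
    \<open>B\<close> in the other.\<close>
  have I: "ennreal (k powr (p - 1)) * I =
      (\<integral>\<^sup>+ x. ennreal (k powr (p - 1) * (\<phi> x * norm (f x) powr p)) \<partial>M)" for k
    unfolding I_def
    by (simp add: nn_integral_density ennreal_mult pos less_imp_le flip: nn_integral_cmult)
  have J: "J = (\<integral>\<^sup>+ x. ennreal (\<phi> x powr (p - 1) * (\<phi> x * norm (f x) powr p)) \<partial>M)"
  proof -
    have "norm (\<phi> x *\<^sub>R f x) powr p = \<phi> x powr (p - 1) * (\<phi> x * norm (f x) powr p)" for x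
      using pos[of x] by (simp add: powr_mult powr_diff)
    then show ?thesis
      unfolding J_def by simp
  qed
  show "ennreal (A powr (p - 1)) * I \<le> J"
    unfolding I J using A \<phi> p
    by (intro nn_integral_mono ennreal_leI mult_right_mono powr_mono2)
       (auto intro!: mult_nonneg_nonneg less_imp_le[OF pos])
  show "J \<le> ennreal (B powr (p - 1)) * I"
    unfolding I J using \<phi> p
    by (intro nn_integral_mono ennreal_leI mult_right_mono powr_mono2)
       (auto intro!: mult_nonneg_nonneg less_imp_le[OF pos])
qed

lemma borel_measurable_dual_group:
  assumes "\<gamma> \<in> dual_group" "sets M = sets borel"
  shows "\<gamma> \<in> borel_measurable M"
  using assms borel_measurable_continuous_onI[of \<gamma>]
  by (simp add: dual_group_def cong: measurable_cong_sets)

lemma fourier_density: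
  assumes \<gamma>: "\<gamma> \<in> dual_group" and sets: "sets M = sets borel"
    and [measurable]: "\<phi> \<in> borel_measurable M" "f \<in> borel_measurable M"
    and \<phi>: "\<And>x. 0 \<le> \<phi> x"
  shows "fourier (density M (\<lambda>x. ennreal (\<phi> x))) f \<gamma> = fourier M (\<lambda>x. \<phi> x *\<^sub>R f x) \<gamma>"
proof -
  have [measurable]: "\<gamma> \<in> borel_measurable M"
    using \<gamma> sets by (rule borel_measurable_dual_group)
  have [measurable]: "(\<lambda>x. cnj (\<gamma> x)) \<in> borel_measurable M"
    by (rule borel_measurable_continuous_on[OF _ \<open>\<gamma> \<in> borel_measurable M\<close>])
       (intro continuous_intros)
  show ?thesis
    unfolding fourier_def using \<phi> by (subst integral_density) auto
qed

text \<open>The frame inequalities for \<mu> are applied to g = \<phi> f; frame bounds c, d for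
  \<mu> become c A^s and d B^s for the density.\<close>

lemma frame_measure_density:
  fixes \<mu> :: "'a::topological_ab_group_add measure"
  assumes frame: "frame_measure p q \<mu> \<nu>" and sets: "sets \<mu> = sets borel"
    and \<phi>[measurable]: "\<phi> \<in> borel_measurable \<mu>"
    and bounds: "\<And>x. A \<le> \<phi> x" "\<And>x. \<phi> x \<le> B" and A: "0 < A" and p: "1 \<le> p" and q: "0 \<le> q"
  shows "frame_measure p q (density \<mu> (\<lambda>x. ennreal (\<phi> x))) \<nu>"
proof -
  define M where "M = density \<mu> (\<lambda>x. ennreal (\<phi> x))"
  \<comment> \<open>The integrals compare with factors A^(p-1) and B^(p-1). The q-th power of the
    norm is the (q/p)-th power of the integral, which raises these factors to the power q/p.\<close>
  define s where "s = (p - 1) * (q / p)"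
  have B: "0 < B" "A \<le> B"
    \<comment> \<open>Evaluating the bounds at any one point gives A \<le> B;
      \<open>undefined\<close> serves as that point.\<close>
    using A bounds[of undefined] by linarith+
  obtain c d where cd: "0 < c" "c \<le> d" and fr:
    "\<And>f. f \<in> Lp_space p \<mu> \<Longrightarrow>
      ennreal c * ennreal_rpow (Lp_norm p \<mu> f) q \<le> ennreal_rpow (Lp_norm q \<nu> (fourier \<mu> f)) q \<and>
      ennreal_rpow (Lp_norm q \<nu> (fourier \<mu> f)) q \<le> ennreal d * ennreal_rpow (Lp_norm p \<mu> f) q"
    and sets_\<nu>: "sets \<nu> = sets dual_borel"
    using frame unfolding frame_measure_def by blast
  have space_\<nu>: "space \<nu> = dual_group"
    using sets_eq_imp_space_eq[OF sets_\<nu>] by (simp add: dual_borel_def space_measure_of_conv)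
  have main: "ennreal (c * A powr s) * ennreal_rpow (Lp_norm p M f) q
        \<le> ennreal_rpow (Lp_norm q \<nu> (fourier M f)) q \<and>
      ennreal_rpow (Lp_norm q \<nu> (fourier M f)) q
        \<le> ennreal (d * B powr s) * ennreal_rpow (Lp_norm p M f) q"
    if f: "f \<in> Lp_space p M" for f
  proof -
    have f_meas[measurable]: "f \<in> borel_measurable \<mu>"
      using f by (simp add: Lp_space_def M_def)
    define g where "g x = \<phi> x *\<^sub>R f x" for x
    have [measurable]: "g \<in> borel_measurable \<mu>"
      unfolding g_def[abs_def] by measurable
    let ?I = "\<integral>\<^sup>+ x. ennreal (norm (f x) powr p) \<partial>M"
    let ?J = "\<integral>\<^sup>+ x. ennreal (norm (g x) powr p) \<partial>\<mu>"
    note IJ = nn_integral_powr_density_bounds[OF \<phi> f_meas bounds A p, folded M_def g_def]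
    have "?I < \<infinity>"
      using f unfolding Lp_space_def Lp_norm_finite_iff by simp
    then have "?J < \<infinity>"
      using IJ(2) by (metis ennreal_mult_less_top ennreal_less_top infinity_ennreal_def le_less_trans)
    then have g: "g \<in> Lp_space p \<mu>"
      unfolding Lp_space_def mem_Collect_eq Lp_norm_finite_iff by simp
    have rpow_cmult: "ennreal_rpow (ennreal (k powr (p - 1)) * x) (q / p)
        = ennreal (k powr s) * ennreal_rpow x (q / p)" if "0 < k" for k x
      using that by (simp add: ennreal_rpow_cmult powr_powr s_def)
    have norm_q: "ennreal_rpow (Lp_norm p N h) q
        = ennreal_rpow (\<integral>\<^sup>+ x. ennreal (norm (h x) powr p) \<partial>N) (q / p)" for N h
      by (simp add: Lp_norm_def ennreal_rpow_rpow)
    have lower: "ennreal (A powr s) * ennreal_rpow (Lp_norm p M f) q \<le> ennreal_rpow (Lp_norm p \<mu> g) q"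
      using ennreal_rpow_mono[OF IJ(1), of "q / p"] p q rpow_cmult[OF A] by (simp add: norm_q)
    have upper: "ennreal_rpow (Lp_norm p \<mu> g) q \<le> ennreal (B powr s) * ennreal_rpow (Lp_norm p M f) q"
      using ennreal_rpow_mono[OF IJ(2), of "q / p"] p q rpow_cmult[OF B(1)] by (simp add: norm_q)
    \<comment> \<open>The transforms are compared at characters, which make up
      \<open>space \<nu>\<close>; this determines the norm over \<nu>.\<close>
    have "fourier M f \<gamma> = fourier \<mu> g \<gamma>" if "\<gamma> \<in> space \<nu>" for \<gamma>
      unfolding M_def g_def[abs_def] using that space_\<nu> sets bounds(1) A
      by (intro fourier_density) (auto intro: order_trans less_imp_le)
    then have F: "Lp_norm q \<nu> (fourier M f) = Lp_norm q \<nu> (fourier \<mu> g)"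
      unfolding Lp_norm_def by (simp cong: nn_integral_cong)
    have "ennreal (c * A powr s) * ennreal_rpow (Lp_norm p M f) q
        \<le> ennreal c * ennreal_rpow (Lp_norm p \<mu> g) q"
      using mult_left_mono[OF lower, of "ennreal c"] cd by (simp add: ennreal_mult mult.assoc)
    moreover have "ennreal d * ennreal_rpow (Lp_norm p \<mu> g) q
        \<le> ennreal (d * B powr s) * ennreal_rpow (Lp_norm p M f) q"
      using mult_left_mono[OF upper, of "ennreal d"] cd by (simp add: ennreal_mult mult.assoc)
    ultimately show ?thesis
      unfolding F using fr[OF g] by (blast intro: order_trans)
  qed
  \<comment> \<open>With a nonnegative exponent, A \<le> B gives A^s \<le> B^s, so the new frame
    bounds are in the required order.\<close>
  have "0 \<le> s"
    unfolding s_def using p q by simp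
  then have "c * A powr s \<le> d * B powr s"
    using cd A B by (intro mult_mono powr_mono2) auto
  moreover have "0 < c * A powr s"
    using cd A by simp
  ultimately show ?thesis
    unfolding frame_measure_def M_def[symmetric] using sets_\<nu> main by blast
qed

text \<open>Integrals over the completion and over \<mu> agree, and a.e. equal densities give the
  same mass to every set of \<mu>. This replaces \<phi> by a function measurable for \<mu>
  itself.\<close>

lemma weighted_measure_eq_density:
  assumes \<phi>: "\<phi> \<in> borel_measurable (completion \<mu>)"
    and \<psi>: "\<psi> \<in> borel_measurable \<mu>" and eq: "AE x in \<mu>. \<phi> x = \<psi> x"
  shows "weighted_measure \<phi> \<mu> = density \<mu> (\<lambda>x. ennreal (\<psi> x))"
proof (rule measure_eqI)
  let ?D = "density (completion \<mu>) (\<lambda>x. ennreal (\<phi> x))"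
  have sub: "subalgebra ?D \<mu>"
    by (simp add: subalgebra_def subset_iff)
  show sets: "sets (weighted_measure \<phi> \<mu>) = sets (density \<mu> (\<lambda>x. ennreal (\<psi> x)))"
    unfolding weighted_measure_def using sub by (simp add: sets_restr_to_subalg)
  fix X assume "X \<in> sets (weighted_measure \<phi> \<mu>)"
  then have X: "X \<in> sets \<mu>"
    using sets by simp
  have "emeasure (weighted_measure \<phi> \<mu>) X = emeasure ?D X"
    unfolding weighted_measure_def using sub X by (rule emeasure_restr_to_subalg)
  also have "\<dots> = (\<integral>\<^sup>+ x. ennreal (\<phi> x) * indicator X x \<partial>\<mu>)"
    using \<phi> X by (subst emeasure_density) (auto simp: nn_integral_completion)
  also have "\<dots> = (\<integral>\<^sup>+ x. ennreal (\<psi> x) * indicator X x \<partial>\<mu>)"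
    using eq by (intro nn_integral_cong_AE) auto
  also have "\<dots> = emeasure (density \<mu> (\<lambda>x. ennreal (\<psi> x))) X"
    using \<psi> X by (subst emeasure_density) auto
  finally show "emeasure (weighted_measure \<phi> \<mu>) X = emeasure (density \<mu> (\<lambda>x. ennreal (\<psi> x))) X" .
qed

theorem theorem2p8:
  fixes \<mu> :: "'a::{topological_ab_group_add, t2_space} measure"
    and \<nu> :: "('a \<Rightarrow> complex) measure"
    and \<phi> :: "'a \<Rightarrow> real"
    and p q A B :: real
  assumes "locally_compact_space (euclidean :: 'a topology)"
    and "metrizable_space (euclidean :: 'a topology)"
    and "\<exists>K :: nat \<Rightarrow> 'a set. (\<forall>n. compact (K n)) \<and> (\<Union>n. K n) = UNIV"
    and "1 < p" and "1 < q"
    and "sets \<mu> = sets borel" and "finite_measure \<mu>"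
    and "\<phi> \<in> borel_measurable (completion \<mu>)"
    and "0 < A"
    and "AE x in \<mu>. x \<in> closed_support \<mu> \<longrightarrow> A \<le> \<phi> x \<and> \<phi> x \<le> B"
    and "sets \<nu> = sets dual_borel"
  shows "frame_measure p q \<mu> \<nu> \<longleftrightarrow> frame_measure p q (weighted_measure \<phi> \<mu>) \<nu>"
proof -
  obtain K :: "nat \<Rightarrow> 'a set" where K: "\<And>n. compact (K n)" "(\<Union>n. K n) = UNIV"
    using assms(3) by blast
  have "AE x in \<mu>. x \<in> closed_support \<mu>"
    by (rule AE_closed_support[OF assms(2) K assms(6,7)])
  with assms(10) have bounds: "AE x in \<mu>. A \<le> \<phi> x \<and> \<phi> x \<le> B"
    by eventually_elim simp
  obtain \<phi>' where \<phi>'[measurable]: "\<phi>' \<in> borel_measurable \<mu>" and eq: "AE x in \<mu>. \<phi> x = \<phi>' x"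
    using completion_ex_borel_measurable_real[OF assms(8)] by blast
  \<comment> \<open>If \<open>\<mu> = 0\<close> then possibly \<open>B < A\<close>, hence the upper bound \<open>max A B\<close>.\<close>
  define \<psi> where "\<psi> = (\<lambda>x. max A (min B (\<phi>' x)))"
  have \<psi>[measurable]: "\<psi> \<in> borel_measurable \<mu>"
    unfolding \<psi>_def by measurable
  \<comment> \<open>Clamping makes the bounds hold at every point, the form that
    \<open>frame_measure_density\<close> needs.\<close>
  have \<psi>_bounds: "A \<le> \<psi> x" "\<psi> x \<le> max A B" for x
    by (auto simp: \<psi>_def)
  have \<psi>_pos: "0 < \<psi> x" for x
    using \<psi>_bounds(1)[of x] \<open>0 < A\<close> by linarith
  define M where "M = density \<mu> (\<lambda>x. ennreal (\<psi> x))"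
  \<comment> \<open>Clamping changes nothing at points where \<phi>' agrees with \<phi> and the
    bounds hold.\<close>
  have "AE x in \<mu>. \<phi> x = \<psi> x"
    using eq bounds by eventually_elim (auto simp: \<psi>_def)
  then have weighted: "weighted_measure \<phi> \<mu> = M"
    unfolding M_def by (rule weighted_measure_eq_density[OF assms(8) \<psi>])
  have inverse: "density M (\<lambda>x. ennreal (1 / \<psi> x)) = \<mu>"
  proof -
    have "ennreal (\<psi> x) * ennreal (1 / \<psi> x) = 1" for x
      using \<psi>_pos[of x] by (simp flip: ennreal_mult)
    then show ?thesis
      unfolding M_def by (subst density_density_eq) (auto simp: density_1)
  qed
  have "frame_measure p q M \<nu>" if "frame_measure p q \<mu> \<nu>"
    unfolding M_def
    by (rule frame_measure_density[OF that assms(6) \<psi> \<psi>_bounds \<open>0 < A\<close>]) (use assms(4,5) in auto)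
  \<comment> \<open>The same lemma, now from \<open>M\<close> with density 1/\<psi>, which lies
    between the reciprocals of \<open>max A B\<close> and \<open>A\<close>.\<close>
  moreover have "frame_measure p q \<mu> \<nu>" if "frame_measure p q M \<nu>"
  proof -
    have "frame_measure p q (density M (\<lambda>x. ennreal (1 / \<psi> x))) \<nu>"
    proof (rule frame_measure_density[OF that])
      show "sets M = sets borel" "(\<lambda>x. 1 / \<psi> x) \<in> borel_measurable M"
        unfolding M_def using assms(6) by simp_all
      show "1 / max A B \<le> 1 / \<psi> x" "1 / \<psi> x \<le> 1 / A" for x
        using \<psi>_bounds[of x] \<psi>_pos[of x] \<open>0 < A\<close> by (simp_all add: frac_le)
    qed (use assms(4,5) \<open>0 < A\<close> in auto)
    then show ?thesis
      unfolding inverse .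
  qed
  ultimately show ?thesis
    unfolding weighted by blast
qed

end
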